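(* Let $0<q<1$, $0<a<q^{-1}$, $0<b<q^{-1}$, $c<0$ and $n,m\in\mathbb{N}$. Then for all $x$, $$\begin{aligned}P_{n+m}(x;a,b,c;q)=\sum_{k=0}^{\min(n,m)}&\frac{(q^{-n},q^{-m},abq^{2n+m+1},xq^{-k}/a,xq^{-k}/c;q)_k}{(q,aq,cq,aq^{n+1},cq^{n+1};q)_k}(ac)^kq^{k(k+n+2)}\\&\times P_{n-k}(x;aq^k,bq^k,cq^k;q)\,P_{m-k}(xq^n;aq^{n+k},bq^{n+k},cq^{n+k};q).\end{aligned}$$
   Context: $\mathbb N=\{0,1,2,\dots\}$. $(y;q)_k=\prod_{j=0}^{k-1}(1-yq^j)$ and $(y_1,\dots,y_r;q)_k=\prod_i(y_i;q)_k$. The big $q$-Jacobi polynomials are $$P_n(x;a,b,c;q)=\sum_{j=0}^n\frac{(q^{-n},abq^{n+1},x;q)_j}{(aq,cq,q;q)_j}q^j.$$ *)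

theory Defs
  imports Complex_Main
begin

definition qpoch :: "'a::field \<Rightarrow> 'a \<Rightarrow> nat \<Rightarrow> 'a" where
  "qpoch y q k = (\<Prod>j<k. 1 - y * q ^ j)"

definition qpochs :: "'a::field list \<Rightarrow> 'a \<Rightarrow> nat \<Rightarrow> 'a" where
  "qpochs ys q k = (\<Prod>y\<leftarrow>ys. qpoch y q k)"

definition big_q_jacobi :: "nat \<Rightarrow> 'a::field \<Rightarrow> 'a \<Rightarrow> 'a \<Rightarrow> 'a \<Rightarrow> 'a \<Rightarrow> 'a" where
  "big_q_jacobi n x a b c q =
     (\<Sum>j=0..n. qpochs [q powi (- int n), a * b * q ^ (n + 1), x] q j
                / qpochs [a * q, c * q, q] q j * q ^ j)"

end

theory Submission
  imports Defs
begin

text \<open>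
  The identity is the \<open>q\<close>-Leibniz rule in disguise. Put
  \<open>w(x;a,b,c) = (x/a, x/c; q)\<^sub>\<infinity> / (x, bx/c; q)\<^sub>\<infinity>\<close> and let \<open>D\<close> be the \<open>q\<close>-difference
  operator \<open>D f(x) = (f(x) - f(qx)) / x\<close>. The Rodrigues formula says that \<open>w(x;a,b,c) P\<^sub>N(x;a,b,c)\<close>
  is a multiple of \<open>D\<^sup>N\<close> applied to the weight with parameters \<open>a q\<^sup>N, b q\<^sup>N, c q\<^sup>N\<close>. Taking
  \<open>N = n + m\<close> and stopping after \<open>m\<close> of the differences leaves \<open>D\<^sup>n\<close> of the product of the weight
  and the polynomial \<open>P\<^sub>m\<close>, both with parameters shifted by \<open>q\<^sup>n\<close>. In its expansion the differences
  of the weight give \<open>P\<^bsub>n-k\<^esub>\<close>, again by Rodrigues, and those of \<open>P\<^sub>m\<close> give \<open>P\<^bsub>m-k\<^esub>\<close>, because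
  \<open>D\<close> lowers the degree and shifts the parameters.

  The infinite products enter only through quotients that are finite products, so the proof is
  purely algebraic and applies one difference at a time, by induction on \<open>n\<close> for all parameters
  and all \<open>x \<noteq> 0\<close>. Three facts carry it. Lemma \<open>big_q_jacobi_raising\<close> is one step of
  the Rodrigues formula with the weights divided out. Lemma \<open>big_q_jacobi_lowering\<close> is the
  difference of a polynomial. By the product rule they turn the \<open>k\<close>-th term for \<open>n\<close> into a
  combination of the terms \<open>k\<close> and \<open>k + 1\<close> for \<open>n + 1\<close> (\<open>leibniz_term_step\<close>), and the
  coefficients then match by a Pascal-type recurrence (\<open>leibniz_coeff_recurrence\<close>).

  The difference quotient loses the point \<open>x = 0\<close>, which is recovered by continuity.
\<close>

section \<open>Finite \<open>q\<close>-shifted factorials\<close>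

lemma qpoch_0 [simp]: "qpoch y q 0 = 1"
  by (simp add: qpoch_def)

lemma qpoch_Suc: "qpoch y q (Suc k) = qpoch y q k * (1 - y * q ^ k)"
  by (simp add: qpoch_def)

lemma qpoch_Suc_shift: "qpoch y q (Suc k) = (1 - y) * qpoch (y * q) q k"
  unfolding qpoch_def by (subst prod.lessThan_Suc_shift) (simp add: mult.assoc)

lemma qpoch_shift: "(1 - y) * qpoch (y * q) q k = qpoch y q k * (1 - y * q ^ k)"
  using qpoch_Suc[of y q k] qpoch_Suc_shift[of y q k] by simp

lemma qpoch_nonzero: "(\<And>i. y * q ^ i \<noteq> 1) \<Longrightarrow> qpoch y q k \<noteq> 0"
  by (induction k) (auto simp: qpoch_Suc)

lemma qpoch_inverse_power_eq_0:
  fixes q :: "'a::field"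
  assumes "q \<noteq> 0" "n < k"
  shows "qpoch (inverse (q ^ n)) q k = 0"
  using assms by (auto simp: qpoch_def intro!: bexI[of _ n])

lemma powi_neg: "(q::'a::field) powi (- int n) = inverse (q ^ n)"
  by (simp add: power_int_minus)

section \<open>Coefficients of the big \<open>q\<close>-Jacobi polynomials\<close>

definition jacobi_coeff :: "nat \<Rightarrow> 'a::field \<Rightarrow> 'a \<Rightarrow> 'a \<Rightarrow> 'a \<Rightarrow> nat \<Rightarrow> 'a" where
  "jacobi_coeff n a b c q j =
     qpoch (inverse (q ^ n)) q j * qpoch (a * b * q ^ (n + 1)) q j
     / (qpoch (a * q) q j * qpoch (c * q) q j * qpoch q q j) * q ^ j"

lemma big_q_jacobi_eq_sum:
  "big_q_jacobi n x a b c q = (\<Sum>j\<le>n. jacobi_coeff n a b c q j * qpoch x q j)"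
  unfolding big_q_jacobi_def qpochs_def jacobi_coeff_def powi_neg
  by (simp add: atMost_atLeast0 mult_ac)

text \<open>
  Under this condition no denominator in the hypergeometric sums vanishes. It is stable under
  multiplying \<open>a\<close> and \<open>c\<close> by powers of \<open>q\<close>, as the induction on the degree needs.
\<close>
definition admissible :: "'a::field \<Rightarrow> 'a \<Rightarrow> 'a \<Rightarrow> bool" where
  "admissible a c q \<longleftrightarrow> q \<noteq> 0 \<and> a \<noteq> 0 \<and> c \<noteq> 0 \<and>
     (\<forall>i. q ^ Suc i \<noteq> 1 \<and> a * q ^ Suc i \<noteq> 1 \<and> c * q ^ Suc i \<noteq> 1)"

lemma admissible_shift:
  assumes "admissible a c q"
  shows "admissible (a * q ^ k) (c * q ^ k) q"
proof -
  have "d * q ^ k * q ^ Suc i = d * q ^ Suc (k + i)" for d i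
    by (simp add: power_add mult_ac)
  then show ?thesis using assms unfolding admissible_def by (metis mult_eq_0_iff power_eq_0_iff)
qed

lemma admissible_nonzero:
  assumes "admissible a c q"
  shows "q \<noteq> 0" "a \<noteq> 0" "c \<noteq> 0"
    "1 - a * q \<noteq> 0" "1 - c * q \<noteq> 0"
    "1 - q * q ^ k \<noteq> 0" "1 - a * q * q ^ k \<noteq> 0" "1 - c * q * q ^ k \<noteq> 0"
    "qpoch q q k \<noteq> 0" "qpoch (a * q) q k \<noteq> 0" "qpoch (c * q) q k \<noteq> 0"
proof -
  have *: "q ^ Suc i \<noteq> 1" "a * q ^ Suc i \<noteq> 1" "c * q ^ Suc i \<noteq> 1" for i
    using assms unfolding admissible_def by blast+
  show "q \<noteq> 0" "a \<noteq> 0" "c \<noteq> 0" using assms unfolding admissible_def by auto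
  show "1 - a * q \<noteq> 0" "1 - c * q \<noteq> 0" using *(2,3)[of 0] by auto
  show "1 - q * q ^ k \<noteq> 0" "1 - a * q * q ^ k \<noteq> 0" "1 - c * q * q ^ k \<noteq> 0"
    using *[of k] by (auto simp: mult.assoc)
  show "qpoch q q k \<noteq> 0" "qpoch (a * q) q k \<noteq> 0" "qpoch (c * q) q k \<noteq> 0"
    by (rule qpoch_nonzero; use * in \<open>simp add: mult.assoc\<close>)+
qed

text \<open>
  This is the raising relation below read off at the basis element \<open>(x;q)\<^bsub>j+1\<^esub>\<close>. All three
  coefficients are multiples of one product \<open>K\<close> of shifted factorials, and what remains is the
  elementary identity \<open>poly\<close>.
\<close>
lemma jacobi_coeff_recurrence:
  fixes a b c q :: "'a::field"
  assumes adm: "admissible a c q"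
  shows "(1 - a * q) * (1 - c * q) * jacobi_coeff (Suc n) a b c q (Suc j) =
     (1 - a * q * q ^ Suc j) * (1 - c * q * q ^ Suc j)
       * (jacobi_coeff n (a * q) (b * q) (c * q) q (Suc j) * inverse (q ^ Suc j))
     - (1 - a * b * q\<^sup>2 * q ^ j)
       * (jacobi_coeff n (a * q) (b * q) (c * q) q j * inverse (q ^ j))"
proof -
  note nz = admissible_nonzero[OF adm]
  define U where "U = qpoch (inverse (q ^ n)) q j"
  define V where "V = qpoch (a * b * q ^ (n + 3)) q j"
  define X where "X = qpoch (a * q * q) q j"
  define Y where "Y = qpoch (c * q * q) q j"
  define Z where "Z = qpoch q q j"
  define K where "K = U * V / (X * Y * Z * (1 - q * q ^ j))"
  note adm1 = admissible_shift[OF adm, of 1, simplified]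
  have XYZ: "X \<noteq> 0" "Y \<noteq> 0" "Z \<noteq> 0"
    unfolding X_def Y_def Z_def using admissible_nonzero[OF adm1] nz by auto
  have ac: "1 - a * q * q ^ Suc j \<noteq> 0" "1 - c * q * q ^ Suc j \<noteq> 0"
    using nz(7,8)[of "Suc j"] by auto
  have shift: "inverse (q ^ Suc n) * q = inverse (q ^ n)"
    using nz(1) by (simp add: field_simps)
  have shift2: "a * b * q ^ (Suc n + 1) * q = a * b * q ^ (n + 3)"
    by (simp add: power_add algebra_simps power2_eq_square power3_eq_cube)
  have shift3: "a * q * (b * q) * q ^ (n + 1) = a * b * q ^ (n + 3)"
    by (simp add: power_add algebra_simps power2_eq_square power3_eq_cube)
  have 1: "(1 - a * q) * (1 - c * q) * jacobi_coeff (Suc n) a b c q (Suc j) =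
      K * ((1 - inverse (q ^ Suc n)) * (1 - a * b * q ^ (n + 2)) * q ^ Suc j)"
    unfolding jacobi_coeff_def qpoch_Suc_shift[of "inverse (q ^ Suc n)"]
      qpoch_Suc_shift[of "a * b * q ^ (Suc n + 1)"]
      qpoch_Suc_shift[of "a * q"] qpoch_Suc_shift[of "c * q"] qpoch_Suc[of q] shift shift2
      U_def[symmetric] V_def[symmetric] X_def[symmetric] Y_def[symmetric] Z_def[symmetric] K_def
    using nz(4,5) nz(6)[of j] XYZ by (simp add: divide_simps)
  have 2: "(1 - a * q * q ^ Suc j) * (1 - c * q * q ^ Suc j)
       * (jacobi_coeff n (a * q) (b * q) (c * q) q (Suc j) * inverse (q ^ Suc j))
     = K * ((1 - inverse (q ^ n) * q ^ j) * (1 - a * b * q ^ (n + 3) * q ^ j))"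
    unfolding jacobi_coeff_def qpoch_Suc shift3
      U_def[symmetric] V_def[symmetric] X_def[symmetric] Y_def[symmetric] Z_def[symmetric] K_def
    using nz(1) nz(6)[of j] XYZ ac by (simp add: divide_simps mult_ac)
  have 3: "jacobi_coeff n (a * q) (b * q) (c * q) q j * inverse (q ^ j) = K * (1 - q * q ^ j)"
    unfolding jacobi_coeff_def shift3
      U_def[symmetric] V_def[symmetric] X_def[symmetric] Y_def[symmetric] Z_def[symmetric] K_def
    using nz(1) nz(6)[of j] XYZ by (simp add: divide_simps)
  have poly: "(1 - inverse (q ^ Suc n)) * (1 - a * b * q ^ (n + 2)) * q ^ Suc j =
      (1 - inverse (q ^ n) * q ^ j) * (1 - a * b * q ^ (n + 3) * q ^ j)
      - (1 - a * b * q\<^sup>2 * q ^ j) * (1 - q * q ^ j)"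
    using nz(1) by (simp add: field_simps power2_eq_square power3_eq_cube power_add)
  show ?thesis
    unfolding 1 2 3 poly
    by (subst right_diff_distrib[of K]) (simp only: mult_ac)
qed

section \<open>Raising and lowering relations\<close>

text \<open>
  With the weight \<open>w\<close> of the introduction this says, up to the factor \<open>a c q\<^sup>2\<close> that clears
  denominators, that \<open>D\<close> maps \<open>w(x;aq,bq,cq) P\<^sub>n(x;aq,bq,cq)\<close> to a multiple of
  \<open>w(x;a,b,c) P\<^bsub>n+1\<^esub>(x;a,b,c)\<close>: the two quadratic factors are the quotients
  \<open>w(x;aq,bq,cq) / w(x;a,b,c)\<close> and \<open>w(qx;aq,bq,cq) / w(x;a,b,c)\<close>. The operator on the left is
  bidiagonal in the basis \<open>(x;q)\<^sub>j\<close>, which reduces the claim to a recurrence between coefficients.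
\<close>
lemma big_q_jacobi_raising:
  fixes a b c q x :: "'a::field"
  assumes adm: "admissible a c q"
  shows "(a * q - x) * (c * q - x) * big_q_jacobi n x (a * q) (b * q) (c * q) q
       - a * q\<^sup>2 * (1 - x) * (c - b * x) * big_q_jacobi n (q * x) (a * q) (b * q) (c * q) q
     = x * (1 - a * q) * (1 - c * q) * big_q_jacobi (Suc n) x a b c q"
proof -
  note nz = admissible_nonzero[OF adm]
  define t where "t j = jacobi_coeff n (a * q) (b * q) (c * q) q j * inverse (q ^ j)" for j
  define s where "s j = jacobi_coeff (Suc n) a b c q j" for j
  define A where "A j = (1 - a * q * q ^ j) * (1 - c * q * q ^ j)" for j
  define B where "B j = 1 - a * b * q ^ 2 * q ^ j" for j
  have basis: "(a * q - x) * (c * q - x) * qpoch x q j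
      - a * q\<^sup>2 * (1 - x) * (c - b * x) * qpoch (q * x) q j
    = x * inverse (q ^ j) * (A j * qpoch x q j - B j * qpoch x q (Suc j))" for j
  proof -
    have shift: "(1 - x) * qpoch (q * x) q j = qpoch x q j * (1 - x * q ^ j)"
      using qpoch_shift[of x q j] by (simp add: mult_ac)
    have "(a * q - x) * (c * q - x) * qpoch x q j
        - a * q\<^sup>2 * (c - b * x) * ((1 - x) * qpoch (q * x) q j)
      = ((a * q - x) * (c * q - x) - a * q\<^sup>2 * (c - b * x) * (1 - x * q ^ j)) * qpoch x q j"
      unfolding shift left_diff_distrib[of "(a * q - x) * (c * q - x)"] by (simp only: mult_ac)
    then have "(a * q - x) * (c * q - x) * qpoch x q j
        - a * q\<^sup>2 * (1 - x) * (c - b * x) * qpoch (q * x) q j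
      = ((a * q - x) * (c * q - x) - a * q\<^sup>2 * (c - b * x) * (1 - x * q ^ j)) * qpoch x q j"
      by (simp only: mult_ac)
    \<comment> \<open>The bracket vanishes at \<open>x = 0\<close>; its linear cofactor is expanded in \<open>1\<close> and \<open>1 - x q\<^sup>j\<close>.\<close>
    also have "(a * q - x) * (c * q - x) - a * q\<^sup>2 * (c - b * x) * (1 - x * q ^ j)
      = x * inverse (q ^ j) * (A j - B j * (1 - x * q ^ j))"
      unfolding A_def B_def using nz(1) by (simp add: field_simps power2_eq_square)
    finally show ?thesis by (simp add: qpoch_Suc algebra_simps)
  qed
  \<comment> \<open>The factor \<open>(q\<^bsup>-n\<^esup>;q)\<^sub>j\<close> kills index \<open>n + 1\<close>, so the sum of the \<open>A j * t j\<close> may run up to \<open>n + 1\<close>.\<close>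
  have t_Suc: "t (Suc n) = 0"
    unfolding t_def jacobi_coeff_def using qpoch_inverse_power_eq_0[OF nz(1), of n "Suc n"] by simp
  have zero: "A 0 * t 0 = (1 - a * q) * (1 - c * q) * s 0"
    by (simp add: A_def t_def s_def jacobi_coeff_def)
  have step: "A (Suc j) * t (Suc j) - B j * t j = (1 - a * q) * (1 - c * q) * s (Suc j)" for j
    unfolding A_def B_def t_def s_def by (rule jacobi_coeff_recurrence[OF adm, symmetric])
  have "(a * q - x) * (c * q - x) * big_q_jacobi n x (a * q) (b * q) (c * q) q
       - a * q\<^sup>2 * (1 - x) * (c - b * x) * big_q_jacobi n (q * x) (a * q) (b * q) (c * q) q
     = (\<Sum>j\<le>n. jacobi_coeff n (a * q) (b * q) (c * q) q j *
         ((a * q - x) * (c * q - x) * qpoch x q j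
          - a * q\<^sup>2 * (1 - x) * (c - b * x) * qpoch (q * x) q j))"
    unfolding big_q_jacobi_eq_sum sum_distrib_left sum_subtractf[symmetric]
    by (intro sum.cong refl) (simp only: right_diff_distrib[of "jacobi_coeff _ _ _ _ _ _"] mult_ac)
  also have "\<dots> = x * ((\<Sum>j\<le>n. A j * t j * qpoch x q j) - (\<Sum>j\<le>n. B j * t j * qpoch x q (Suc j)))"
    unfolding basis t_def sum_subtractf[symmetric] sum_distrib_left
    by (intro sum.cong refl) (simp only: right_diff_distrib mult_ac)
  also have "(\<Sum>j\<le>n. A j * t j * qpoch x q j) = (\<Sum>j\<le>Suc n. A j * t j * qpoch x q j)"
    by (simp add: t_Suc)
  also have "\<dots> = A 0 * t 0 + (\<Sum>j\<le>n. A (Suc j) * t (Suc j) * qpoch x q (Suc j))"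
    by (simp only: sum.atMost_Suc_shift qpoch_0 mult_1_right)
  also have "\<dots> - (\<Sum>j\<le>n. B j * t j * qpoch x q (Suc j))
      = A 0 * t 0 + (\<Sum>j\<le>n. (A (Suc j) * t (Suc j) - B j * t j) * qpoch x q (Suc j))"
    by (simp add: sum_subtractf left_diff_distrib)
  also have "\<dots> = (\<Sum>j\<le>Suc n. (1 - a * q) * (1 - c * q) * s j * qpoch x q j)"
    unfolding sum.atMost_Suc_shift zero step by simp
  also have "\<dots> = (1 - a * q) * (1 - c * q) * big_q_jacobi (Suc n) x a b c q"
    unfolding big_q_jacobi_eq_sum s_def sum_distrib_left by (simp only: mult.assoc)
  finally show ?thesis by (simp only: mult.assoc)
qed

text \<open>
  The basis satisfies \<open>(x;q)\<^sub>j - (qx;q)\<^sub>j = -x (1 - q\<^sup>j) (qx;q)\<^bsub>j-1\<^esub>\<close>, and \<open>1 - q\<^sup>j\<close> cancels the last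
  factor of \<open>(q;q)\<^sub>j\<close>. For \<open>n = 0\<close> the factor \<open>1 - q\<^bsup>-n\<^esup>\<close> is zero, so the truncated index
  \<open>n - 1\<close> is harmless.
\<close>
lemma big_q_jacobi_lowering:
  fixes a b c q x :: "'a::field"
  assumes adm: "admissible a c q"
  shows "(1 - a * q) * (1 - c * q) * (big_q_jacobi n x a b c q - big_q_jacobi n (q * x) a b c q)
     = - x * q * (1 - inverse (q ^ n)) * (1 - a * b * q ^ (n + 1))
        * big_q_jacobi (n - 1) (q * x) (a * q) (b * q) (c * q) q"
proof (cases n)
  case 0
  then show ?thesis by (simp add: big_q_jacobi_eq_sum)
next
  case (Suc N)
  note nz = admissible_nonzero[OF adm]
  have basis: "qpoch x q (Suc j) - qpoch (q * x) q (Suc j) = - x * (1 - q * q ^ j) * qpoch (q * x) q j" for j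
    unfolding qpoch_Suc_shift[of x] qpoch_Suc[of "q * x"] by (simp add: algebra_simps)
  have coeff: "(1 - a * q) * (1 - c * q) * (1 - q * q ^ j) * jacobi_coeff (Suc N) a b c q (Suc j)
      = q * (1 - inverse (q ^ n)) * (1 - a * b * q ^ (n + 1))
        * jacobi_coeff N (a * q) (b * q) (c * q) q j" for j
  proof -
    have shift: "inverse (q ^ Suc N) * q = inverse (q ^ N)"
      using nz(1) by (simp add: field_simps)
    have shift2: "a * b * q ^ (Suc N + 1) * q = a * q * (b * q) * q ^ (N + 1)"
      by (simp add: algebra_simps)
    show ?thesis
      unfolding jacobi_coeff_def qpoch_Suc_shift[of "inverse (q ^ Suc N)"]
        qpoch_Suc_shift[of "a * b * q ^ (Suc N + 1)"]
        qpoch_Suc_shift[of "a * q"] qpoch_Suc_shift[of "c * q"] qpoch_Suc[of q] shift shift2 Suc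
      using nz(4-6) by (simp add: mult_ac)
  qed
  have diff: "big_q_jacobi n x a b c q - big_q_jacobi n (q * x) a b c q
      = (\<Sum>j\<le>N. jacobi_coeff (Suc N) a b c q (Suc j)
        * (- x * (1 - q * q ^ j) * qpoch (q * x) q j))"
  proof -
    have "big_q_jacobi n x a b c q - big_q_jacobi n (q * x) a b c q
        = (\<Sum>j\<le>Suc N. jacobi_coeff (Suc N) a b c q j * (qpoch x q j - qpoch (q * x) q j))"
      unfolding big_q_jacobi_eq_sum Suc by (simp only: sum_subtractf right_diff_distrib)
    then show ?thesis
      unfolding sum.atMost_Suc_shift basis by simp
  qed
  have "(1 - a * q) * (1 - c * q) * (big_q_jacobi n x a b c q - big_q_jacobi n (q * x) a b c q)
      = (\<Sum>j\<le>N. (- x * qpoch (q * x) q j) * ((1 - a * q) * (1 - c * q) * (1 - q * q ^ j)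
        * jacobi_coeff (Suc N) a b c q (Suc j)))"
    unfolding diff sum_distrib_left by (intro sum.cong refl) (simp only: mult_ac)
  also have "\<dots> = - x * q * (1 - inverse (q ^ n)) * (1 - a * b * q ^ (n + 1))
        * big_q_jacobi N (q * x) (a * q) (b * q) (c * q) q"
    unfolding coeff big_q_jacobi_eq_sum sum_distrib_left by (intro sum.cong refl) (simp only: mult_ac)
  also have "N = n - 1"
    using Suc by simp
  finally show ?thesis .
qed

section \<open>One step of the \<open>q\<close>-Leibniz expansion\<close>

definition leibniz_coeff :: "nat \<Rightarrow> nat \<Rightarrow> 'a::field \<Rightarrow> 'a \<Rightarrow> 'a \<Rightarrow> 'a \<Rightarrow> nat \<Rightarrow> 'a" where
  "leibniz_coeff n m a b c q k =
     qpoch (inverse (q ^ n)) q k * qpoch (inverse (q ^ m)) q k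
       * qpoch (a * b * q ^ (2 * n + m + 1)) q k
     / (qpoch q q k * qpoch (a * q) q k * qpoch (c * q) q k
       * qpoch (a * q ^ (n + 1)) q k * qpoch (c * q ^ (n + 1)) q k)
     * (a * c) ^ k * q ^ (k * (k + n + 2))"

text \<open>
  The quotient \<open>w(x; a q\<^sup>k, b q\<^sup>k, c q\<^sup>k) / w(x;a,b,c)\<close> of the weights of the introduction;
  \<open>b\<close> drops out since it enters \<open>w\<close> only through \<open>b / c\<close>.
\<close>
definition weight_ratio :: "'a::field \<Rightarrow> 'a \<Rightarrow> 'a \<Rightarrow> nat \<Rightarrow> 'a \<Rightarrow> 'a" where
  "weight_ratio a c q k x =
     qpoch (x * inverse (q ^ k) / a) q k * qpoch (x * inverse (q ^ k) / c) q k"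

definition leibniz_term :: "nat \<Rightarrow> nat \<Rightarrow> 'a::field \<Rightarrow> 'a \<Rightarrow> 'a \<Rightarrow> 'a \<Rightarrow> 'a \<Rightarrow> nat \<Rightarrow> 'a" where
  "leibniz_term n m x a b c q k =
     weight_ratio a c q k x
     * big_q_jacobi (n - k) x (a * q ^ k) (b * q ^ k) (c * q ^ k) q
     * big_q_jacobi (m - k) (x * q ^ n) (a * q ^ (n + k)) (b * q ^ (n + k)) (c * q ^ (n + k)) q"

text \<open>
  This is Pascal's rule in \<open>q\<close>-form. After removing the common factor \<open>K\<close> it becomes
  \<open>(1 - q\<^bsup>-n-1\<^esup>) q\<^bsup>k+1\<^esup> = (1 - q\<^bsup>k-n\<^esup>) - (1 - q\<^bsup>k+1\<^esup>)\<close>.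
\<close>
lemma leibniz_coeff_recurrence:
  fixes a b c q :: "'a::field"
  assumes adm: "admissible a c q"
  shows "(1 - a * q) * (1 - c * q) * leibniz_coeff (Suc n) m a b c q (Suc k) =
     (1 - a * q * q ^ Suc k) * (1 - c * q * q ^ Suc k) / q ^ (2 * Suc k)
        * leibniz_coeff n m (a * q) (b * q) (c * q) q (Suc k)
     - a * c * q ^ (n + 3) * (1 - inverse (q ^ m) * q ^ k)
        * (1 - a * b * q ^ (2 * n + m + 3) * q ^ k)
        / ((1 - a * q ^ (n + 2) * q ^ k) * (1 - c * q ^ (n + 2) * q ^ k))
        * leibniz_coeff n m (a * q) (b * q) (c * q) q k"
proof -
  note nz = admissible_nonzero[OF adm]
  define U where "U = qpoch (inverse (q ^ n)) q k"
  define M where "M = qpoch (inverse (q ^ m)) q k"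
  define V where "V = qpoch (a * b * q ^ (2 * n + m + 3)) q k"
  define X where "X = qpoch (a * q * q) q k"
  define Y where "Y = qpoch (c * q * q) q k"
  define Z where "Z = qpoch q q k"
  define F where "F = qpoch (a * q ^ (n + 2)) q k"
  define G where "G = qpoch (c * q ^ (n + 2)) q k"
  define M' where "M' = 1 - inverse (q ^ m) * q ^ k"
  define V' where "V' = 1 - a * b * q ^ (2 * n + m + 3) * q ^ k"
  define F' where "F' = 1 - a * q ^ (n + 2) * q ^ k"
  define G' where "G' = 1 - c * q ^ (n + 2) * q ^ k"
  define e where "e = q ^ (k * (k + n + 2))"
  define K where "K = U * (M * M') * (V * V') / (X * Y * (Z * (1 - q * q ^ k)) * (F * F') * (G * G'))
    * (a * c) ^ Suc k * (e * q ^ (2 * k + n + 3))"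
  note adm1 = admissible_shift[OF adm, of 1, simplified]
  note admn = admissible_shift[OF adm, of "Suc n"]
  have XYZ: "X \<noteq> 0" "Y \<noteq> 0" "Z \<noteq> 0"
    unfolding X_def Y_def Z_def using admissible_nonzero[OF adm1] nz by auto
  have FG: "F \<noteq> 0" "G \<noteq> 0" "F' \<noteq> 0" "G' \<noteq> 0"
    unfolding F_def G_def F'_def G'_def
    using admissible_nonzero(7,8,10,11)[OF admn, of k] by (simp_all add: mult_ac)
  have acS: "d * q * q ^ Suc k = d * q * q * q ^ k" for d
    by (simp add: mult_ac)
  have ac: "1 - a * q * q * q ^ k \<noteq> 0" "1 - c * q * q * q ^ k \<noteq> 0"
    using nz(7,8)[of "Suc k"] by (simp_all add: mult_ac)
  have shift: "inverse (q ^ Suc n) * q = inverse (q ^ n)"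
    using nz(1) by (simp add: field_simps)
  have idx: "a * b * q ^ (2 * Suc n + m + 1) = a * b * q ^ (2 * n + m + 3)"
    "a * q * (b * q) * q ^ (2 * n + m + 1) = a * b * q ^ (2 * n + m + 3)"
    "d * q ^ (Suc n + 1) = d * q ^ (n + 2)"
    "d * q * q ^ (n + 1) = d * q ^ (n + 2)" for d
    by (simp_all add: power_add algebra_simps power2_eq_square power3_eq_cube)
  have e1: "q ^ (Suc k * (Suc k + Suc n + 2)) = e * q ^ (2 * k + n + 3) * q ^ Suc k"
    unfolding e_def power_add[symmetric] by (rule arg_cong[where f = "power q"]) (simp add: algebra_simps)
  have e2: "q ^ (Suc k * (Suc k + n + 2)) = e * q ^ (2 * k + n + 3)"
    unfolding e_def power_add[symmetric] by (rule arg_cong[where f = "power q"]) (simp add: algebra_simps)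
  have e3: "(a * q * (c * q)) ^ i = (a * c) ^ i * q ^ (2 * i)" for i
    by (simp add: power_mult_distrib mult_2 power_add)
  have 1: "(1 - a * q) * (1 - c * q) * leibniz_coeff (Suc n) m a b c q (Suc k)
     = K * ((1 - inverse (q ^ Suc n)) * q ^ Suc k)"
    unfolding leibniz_coeff_def idx e1 qpoch_Suc_shift[of "inverse (q ^ Suc n)"]
      qpoch_Suc_shift[of "a * q"] qpoch_Suc_shift[of "c * q"] shift
      qpoch_Suc[of q] qpoch_Suc[of "inverse (q ^ m)"] qpoch_Suc[of "d * q ^ (n + 2)" for d]
      qpoch_Suc[of "a * b * q ^ (2 * n + m + 3)"]
      U_def[symmetric] V_def[symmetric] X_def[symmetric] Y_def[symmetric] Z_def[symmetric]
      M_def[symmetric] M'_def[symmetric] V'_def[symmetric] F_def[symmetric] F'_def[symmetric]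
      G_def[symmetric] G'_def[symmetric] K_def
    using nz(4,5) by (simp only: times_divide_eq_left times_divide_eq_right) (simp add: mult_ac)
  have 2: "(1 - a * q * q ^ Suc k) * (1 - c * q * q ^ Suc k) / q ^ (2 * Suc k)
        * leibniz_coeff n m (a * q) (b * q) (c * q) q (Suc k)
     = K * (1 - inverse (q ^ n) * q ^ k)"
    unfolding leibniz_coeff_def idx e2 e3 qpoch_Suc acS
      U_def[symmetric] V_def[symmetric] X_def[symmetric] Y_def[symmetric] Z_def[symmetric]
      M_def[symmetric] M'_def[symmetric] V'_def[symmetric] F_def[symmetric] F'_def[symmetric]
      G_def[symmetric] G'_def[symmetric] K_def
    using nz(1) ac by (simp add: mult_ac del: power_Suc mult_Suc_right)
  have 3: "a * c * q ^ (n + 3) * M' * V' / (F' * G') * leibniz_coeff n m (a * q) (b * q) (c * q) q k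
     = K * (1 - q * q ^ k)"
    unfolding leibniz_coeff_def idx e3
      U_def[symmetric] V_def[symmetric] X_def[symmetric] Y_def[symmetric] Z_def[symmetric]
      M_def[symmetric] F_def[symmetric] G_def[symmetric] K_def e_def[symmetric]
    using nz(6)[of k] by (simp add: mult_ac power_add)
  have poly: "(1 - inverse (q ^ Suc n)) * q ^ Suc k = (1 - inverse (q ^ n) * q ^ k) - (1 - q * q ^ k)"
    using nz(1) by (simp add: field_simps)
  show ?thesis
    unfolding M'_def[symmetric] V'_def[symmetric] F'_def[symmetric] G'_def[symmetric] 1 2 3 poly
    by (simp only: right_diff_distrib)
qed

text \<open>
  The product rule \<open>D(fg)(x) = f(x) Dg(x) + g(qx) Df(x)\<close>, where \<open>f\<close> is the weight with parameters
  \<open>a q\<^bsup>k+1\<^esup>, b q\<^bsup>k+1\<^esup>, c q\<^bsup>k+1\<^esup>\<close> times the polynomial of degree \<open>n - k\<close>, and \<open>g\<close> is the polynomial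
  of degree \<open>m - k\<close>. Raising evaluates \<open>Df\<close> and yields the term of index \<open>k\<close>; lowering evaluates
  \<open>Dg\<close> and yields the term of index \<open>k + 1\<close>.
\<close>
lemma leibniz_term_step:
  fixes a b c q x :: "'a::field"
  assumes adm: "admissible a c q" and "k \<le> n" "k \<le> m"
  shows "(a * q - x) * (c * q - x) * leibniz_term n m x (a * q) (b * q) (c * q) q k
       - a * q\<^sup>2 * (1 - x) * (c - b * x) * leibniz_term n m (q * x) (a * q) (b * q) (c * q) q k
    = x * ((1 - a * q * q ^ k) * (1 - c * q * q ^ k) / q ^ (2 * k)
        * leibniz_term (Suc n) m x a b c q k
      - a * c * q ^ (n + 3) * (1 - inverse (q ^ m) * q ^ k)
        * (1 - a * b * q ^ (2 * n + m + 3) * q ^ k)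
        / ((1 - a * q ^ (n + 2) * q ^ k) * (1 - c * q ^ (n + 2) * q ^ k))
        * leibniz_term (Suc n) m x a b c q (Suc k))"
proof -
  note nz = admissible_nonzero[OF adm]
  define W where "W = weight_ratio a c q k x"
  define W' where "W' = weight_ratio a c q (Suc k) x"
  define p where "p y = big_q_jacobi (n - k) y (a * q * q ^ k) (b * q * q ^ k) (c * q * q ^ k) q" for y
  define v where "v y = big_q_jacobi (m - k) y
      (a * q * q ^ (n + k)) (b * q * q ^ (n + k)) (c * q * q ^ (n + k)) q" for y
  define P where "P = big_q_jacobi (Suc n - k) x (a * q ^ k) (b * q ^ k) (c * q ^ k) q"
  define Q where "Q = big_q_jacobi (m - Suc k) (x * q ^ Suc n)
      (a * q ^ (Suc n + Suc k)) (b * q ^ (Suc n + Suc k)) (c * q ^ (Suc n + Suc k)) q"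
  define D where "D = (1 - a * q ^ (n + 2) * q ^ k) * (1 - c * q ^ (n + 2) * q ^ k)"
  define L where "L = (1 - inverse (q ^ m) * q ^ k) * (1 - a * b * q ^ (2 * n + m + 3) * q ^ k)"
  have D: "D \<noteq> 0"
    using admissible_nonzero(7,8)[OF admissible_shift[OF adm, of "Suc n"], of k]
    unfolding D_def by (simp add: mult_ac)
  have W1: "(a * q - x) * (c * q - x) * weight_ratio (a * q) (c * q) q k x = a * c * q\<^sup>2 * W'"
  proof -
    have "(d * q - x) * qpoch (x * inverse (q ^ k) / (d * q)) q k
        = d * q * qpoch (x * inverse (q ^ Suc k) / d) q (Suc k)" if "d \<noteq> 0" for d
      unfolding qpoch_Suc using nz(1) that by (simp add: field_simps)
    from this[OF nz(2)] this[OF nz(3)] show ?thesis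
      unfolding W'_def weight_ratio_def power2_eq_square by algebra
  qed
  have W2: "weight_ratio (a * q) (c * q) q k (q * x) = W"
    unfolding W_def weight_ratio_def using nz(1-3) by (simp add: field_simps)
  have W3: "(a * q ^ k * q - x) * (c * q ^ k * q - x) * W = a * c * q\<^sup>2 * q ^ (2 * k) * W'"
  proof -
    have "(d * q ^ k * q - x) * qpoch (x * inverse (q ^ k) / d) q k
        = d * q ^ k * q * qpoch (x * inverse (q ^ Suc k) / d) q (Suc k)" if "d \<noteq> 0" for d
    proof -
      have "x * inverse (q ^ Suc k) / d * q = x * inverse (q ^ k) / d"
        using nz(1) by (simp add: field_simps)
      then show ?thesis
        unfolding qpoch_Suc_shift using nz(1) that by (simp add: field_simps)
    qed
    from arg_cong2[OF this[OF nz(2)] this[OF nz(3)], of "(*)"] show ?thesis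
      unfolding W_def W'_def weight_ratio_def power2_eq_square mult_2 power_add
      by (simp only: mult_ac)
  qed
  have raise: "(a * q ^ k * q - x) * (c * q ^ k * q - x) * p x
       - a * q ^ k * q\<^sup>2 * (1 - x) * (c * q ^ k - b * q ^ k * x) * p (q * x)
     = x * (1 - a * q * q ^ k) * (1 - c * q * q ^ k) * P"
    using big_q_jacobi_raising[OF admissible_shift[OF adm, of k], of x "n - k" "b * q ^ k"] assms(2)
    unfolding p_def P_def by (simp add: Suc_diff_le mult_ac)
  have lower: "D * (v (x * q ^ n) - v (q * (x * q ^ n))) = - x * q ^ (n + 1) * L * Q"
  proof -
    have i: "inverse (q ^ (m - k)) = inverse (q ^ m) * q ^ k"
      using assms(3) nz(1) by (simp add: power_diff field_simps)
    have "2 * n + m + 3 + k = (m - k + 1) + 2 * Suc (n + k)"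
      using assms(3) by simp
    then have ii: "a * b * q ^ (2 * n + m + 3) * q ^ k
        = a * q * q ^ (n + k) * (b * q * q ^ (n + k)) * q ^ (m - k + 1)"
      unfolding mult.assoc power_add[symmetric]
      by (simp only: power_add mult_2 power_Suc mult_ac)
    have iii: "m - k - 1 = m - Suc k" by simp
    show ?thesis
      using big_q_jacobi_lowering[OF admissible_shift[OF adm, of "Suc (n + k)"],
          of "m - k" "x * q ^ n" "b * q ^ Suc (n + k)"]
      unfolding D_def L_def ii v_def Q_def i iii by (simp add: mult_ac power_add power2_eq_square)
  qed
  define w where "w = q ^ (2 * k)"
  have w: "w \<noteq> 0" unfolding w_def using nz(1) by simp
  define r where "r = a * q\<^sup>2 * (1 - x) * (c - b * x)"
  have 1: "leibniz_term n m x (a * q) (b * q) (c * q) q k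
      = weight_ratio (a * q) (c * q) q k x * p x * v (x * q ^ n)"
    unfolding leibniz_term_def p_def v_def ..
  have 2: "leibniz_term n m (q * x) (a * q) (b * q) (c * q) q k
      = W * p (q * x) * v (q * (x * q ^ n))"
    unfolding leibniz_term_def p_def v_def W2 by (simp only: mult_ac)
  have 3: "leibniz_term (Suc n) m x a b c q k = W * P * v (q * (x * q ^ n))"
    unfolding leibniz_term_def W_def P_def v_def by (simp add: mult_ac)
  have 4: "leibniz_term (Suc n) m x a b c q (Suc k) = W' * p x * Q"
    unfolding leibniz_term_def W'_def p_def Q_def by (simp add: mult_ac)
  have first: "x * ((1 - a * q * q ^ k) * (1 - c * q * q ^ k) / w * (W * P))
      = a * c * q\<^sup>2 * W' * p x - r * (W * p (q * x))"
  proof -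
    have "a * q ^ k * q\<^sup>2 * (1 - x) * (c * q ^ k - b * q ^ k * x) = r * w"
      unfolding r_def w_def mult_2 power_add by (simp add: algebra_simps)
    note raise = raise[unfolded this]
    have "x * ((1 - a * q * q ^ k) * (1 - c * q * q ^ k)) * (W * P)
      = W * (x * (1 - a * q * q ^ k) * (1 - c * q * q ^ k) * P)"
      by (simp only: mult_ac)
    also have "\<dots> = ((a * q ^ k * q - x) * (c * q ^ k * q - x) * W) * p x - r * w * (W * p (q * x))"
      unfolding raise[symmetric] right_diff_distrib[of W] by (simp only: mult_ac)
    finally have "x * ((1 - a * q * q ^ k) * (1 - c * q * q ^ k)) * (W * P)
      = w * (a * c * q\<^sup>2 * W' * p x - r * (W * p (q * x)))"
      unfolding W3 w_def[symmetric] by (simp add: algebra_simps)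
    then show ?thesis using w by (simp add: field_simps)
  qed
  have second: "x * (a * c * q ^ (n + 3) * L / D * Q)
      = - (a * c * q\<^sup>2 * (v (x * q ^ n) - v (q * (x * q ^ n))))"
  proof -
    have "x * (a * c * q ^ (n + 3) * L / D * Q) = - (a * c * q\<^sup>2 * (- x * q ^ (n + 1) * L * Q / D))"
      by (simp add: power_add power2_eq_square power3_eq_cube mult_ac)
    also have "- x * q ^ (n + 1) * L * Q / D = v (x * q ^ n) - v (q * (x * q ^ n))"
      unfolding lower[symmetric] using D by simp
    finally show ?thesis .
  qed
  have "(a * q - x) * (c * q - x) * leibniz_term n m x (a * q) (b * q) (c * q) q k
       - r * leibniz_term n m (q * x) (a * q) (b * q) (c * q) q k
     = a * c * q\<^sup>2 * W' * p x * v (x * q ^ n) - r * (W * p (q * x)) * v (q * (x * q ^ n))"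
    unfolding 1 2 W1[symmetric] by (simp only: mult_ac)
  also have "\<dots> = (a * c * q\<^sup>2 * W' * p x - r * (W * p (q * x))) * v (q * (x * q ^ n))
      - (- (a * c * q\<^sup>2 * (v (x * q ^ n) - v (q * (x * q ^ n))))) * (W' * p x)"
    by (simp add: algebra_simps)
  also have "\<dots> = x * ((1 - a * q * q ^ k) * (1 - c * q * q ^ k) / w * (W * P * v (q * (x * q ^ n)))
        - a * c * q ^ (n + 3) * L / D * (W' * p x * Q))"
    unfolding first[symmetric] second[symmetric] right_diff_distrib[of x]
    by (simp only: times_divide_eq_left times_divide_eq_right mult_ac)
  finally show ?thesis
    unfolding 3 4 r_def w_def L_def D_def by (simp only: mult.assoc)
qed

section \<open>The expansion\<close>

text \<open>
  The raising operator is applied to the expansion of \<open>P\<^bsub>n+m\<^esub>\<close> with parameters \<open>aq, bq, cq\<close>. It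
  evaluates that polynomial at both \<open>x\<close> and \<open>qx\<close>, hence the induction over all nonzero \<open>x\<close>; the
  factor \<open>x\<close> that it produces is cancelled at the end. Summing up to \<open>n\<close> instead of
  \<open>min n m\<close> changes nothing because \<open>(q\<^bsup>-m\<^esup>;q)\<^sub>k\<close> vanishes for \<open>k > m\<close>.
\<close>
lemma big_q_jacobi_add_nonzero:
  fixes a b c q x :: "'a::field"
  assumes "admissible a c q" and "x \<noteq> 0"
  shows "big_q_jacobi (n + m) x a b c q =
     (\<Sum>k\<le>n. leibniz_coeff n m a b c q k * leibniz_term n m x a b c q k)"
  using assms
proof (induction n arbitrary: a b c x)
  case 0
  then show ?case
    by (simp add: leibniz_coeff_def leibniz_term_def weight_ratio_def)
      (simp add: big_q_jacobi_eq_sum jacobi_coeff_def)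
next
  case (Suc n)
  note adm = Suc.prems(1)
  note nz = admissible_nonzero[OF adm]
  have adm1: "admissible (a * q) (c * q) q"
    using admissible_shift[OF adm, of 1] by simp
  define E where "E k = leibniz_coeff n m (a * q) (b * q) (c * q) q k" for k
  define E' where "E' k = leibniz_coeff (Suc n) m a b c q k" for k
  define T where "T k = leibniz_term (Suc n) m x a b c q k" for k
  define A where "A k = (1 - a * q * q ^ k) * (1 - c * q * q ^ k) / q ^ (2 * k)" for k
  define B where "B k = a * c * q ^ (n + 3) * (1 - inverse (q ^ m) * q ^ k)
        * (1 - a * b * q ^ (2 * n + m + 3) * q ^ k)
        / ((1 - a * q ^ (n + 2) * q ^ k) * (1 - c * q ^ (n + 2) * q ^ k))" for k
  have IH: "big_q_jacobi (n + m) y (a * q) (b * q) (c * q) q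
      = (\<Sum>k\<le>n. E k * leibniz_term n m y (a * q) (b * q) (c * q) q k)" if "y \<noteq> 0" for y
    unfolding E_def by (rule Suc.IH[OF adm1 that])
  have step: "E k * ((a * q - x) * (c * q - x) * leibniz_term n m x (a * q) (b * q) (c * q) q k
       - a * q\<^sup>2 * (1 - x) * (c - b * x) * leibniz_term n m (q * x) (a * q) (b * q) (c * q) q k)
     = E k * (x * (A k * T k - B k * T (Suc k)))" if "k \<le> n" for k
  proof (cases "k \<le> m")
    case True
    show ?thesis
      unfolding leibniz_term_step[OF adm that True] A_def B_def T_def ..
  next
    case False
    then have "E k = 0"
      unfolding E_def leibniz_coeff_def using qpoch_inverse_power_eq_0[OF nz(1), of m k] by simp
    then show ?thesis by simp
  qed
  have E_Suc: "E (Suc n) = 0"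
    unfolding E_def leibniz_coeff_def using qpoch_inverse_power_eq_0[OF nz(1), of n "Suc n"] by simp
  have zero: "A 0 * E 0 = (1 - a * q) * (1 - c * q) * E' 0"
    by (simp add: A_def E_def E'_def leibniz_coeff_def)
  have rec: "A (Suc k) * E (Suc k) - B k * E k = (1 - a * q) * (1 - c * q) * E' (Suc k)" for k
    unfolding A_def B_def E_def E'_def by (rule leibniz_coeff_recurrence[OF adm, symmetric])
  have "x * (1 - a * q) * (1 - c * q) * big_q_jacobi (Suc (n + m)) x a b c q
    = (\<Sum>k\<le>n. E k *
        ((a * q - x) * (c * q - x) * leibniz_term n m x (a * q) (b * q) (c * q) q k
       - a * q\<^sup>2 * (1 - x) * (c - b * x) * leibniz_term n m (q * x) (a * q) (b * q) (c * q) q k))"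
    using IH[of x] IH[of "q * x"] Suc.prems(2) nz(1)
    unfolding big_q_jacobi_raising[OF adm, symmetric]
    by (simp add: sum_distrib_left sum_subtractf right_diff_distrib mult.left_commute)
  also have "\<dots> = (\<Sum>k\<le>n. E k * (x * (A k * T k - B k * T (Suc k))))"
    by (intro sum.cong refl step) simp
  also have "\<dots> = x * ((\<Sum>k\<le>n. A k * E k * T k) - (\<Sum>k\<le>n. B k * E k * T (Suc k)))"
    by (simp add: sum_distrib_left sum_subtractf right_diff_distrib mult_ac)
  also have "(\<Sum>k\<le>n. A k * E k * T k) = (\<Sum>k\<le>Suc n. A k * E k * T k)"
    by (simp add: E_Suc)
  also have "\<dots> = A 0 * E 0 * T 0 + (\<Sum>k\<le>n. A (Suc k) * E (Suc k) * T (Suc k))"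
    by (simp only: sum.atMost_Suc_shift)
  also have "\<dots> - (\<Sum>k\<le>n. B k * E k * T (Suc k))
      = A 0 * E 0 * T 0 + (\<Sum>k\<le>n. (A (Suc k) * E (Suc k) - B k * E k) * T (Suc k))"
    by (simp add: sum_subtractf left_diff_distrib)
  also have "\<dots> = (\<Sum>k\<le>Suc n. (1 - a * q) * (1 - c * q) * E' k * T k)"
    unfolding sum.atMost_Suc_shift zero rec ..
  also have "x * \<dots> = x * (1 - a * q) * (1 - c * q) * (\<Sum>k\<le>Suc n. E' k * T k)"
    by (simp only: sum_distrib_left mult.assoc)
  finally show ?case
    using Suc.prems(2) nz(4,5) unfolding E'_def T_def by simp
qed

lemma continuous_qpoch:
  fixes f :: "'b::t2_space \<Rightarrow> 'a::real_normed_field"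
  assumes "isCont f x"
  shows "isCont (\<lambda>x. qpoch (f x) q k) x"
  unfolding qpoch_def using assms by (intro continuous_intros)

lemma continuous_big_q_jacobi:
  fixes f :: "'b::t2_space \<Rightarrow> 'a::real_normed_field"
  assumes "isCont f x"
  shows "isCont (\<lambda>x. big_q_jacobi n (f x) a b c q) x"
  unfolding big_q_jacobi_eq_sum by (intro continuous_intros continuous_qpoch assms)

text \<open>Both sides are polynomials in \<open>x\<close> that agree off \<open>0\<close>, hence also at \<open>0\<close>.\<close>
lemma big_q_jacobi_add:
  fixes a b c q x :: "'a::real_normed_field"
  assumes adm: "admissible a c q"
  shows "big_q_jacobi (n + m) x a b c q =
     (\<Sum>k\<le>n. leibniz_coeff n m a b c q k * leibniz_term n m x a b c q k)"
proof (cases "x = 0")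
  case False
  then show ?thesis by (rule big_q_jacobi_add_nonzero[OF adm])
next
  case True
  define f where "f y = big_q_jacobi (n + m) y a b c q
    - (\<Sum>k\<le>n. leibniz_coeff n m a b c q k * leibniz_term n m y a b c q k)" for y
  have "isCont f 0"
    unfolding f_def leibniz_term_def weight_ratio_def
    using admissible_nonzero(2,3)[OF adm]
    by (intro continuous_intros continuous_qpoch continuous_big_q_jacobi) auto
  then have "f \<midarrow>0\<rightarrow> f 0"
    by (simp add: isCont_def)
  moreover have "f \<midarrow>0\<rightarrow> 0"
    using big_q_jacobi_add_nonzero[OF adm, of _ n m b]
    by (intro tendsto_eventually) (auto simp: f_def eventually_at_filter)
  ultimately have "f 0 = 0"
    by (rule LIM_unique)
  with True show ?thesis by (simp add: f_def)
qed

theorem mainTheorem12: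
  fixes q a b c :: real and x :: complex and n m :: nat
  assumes "0 < q" "q < 1"
    and "0 < a" "a < inverse q"
    and "0 < b" "b < inverse q"
    and "c < 0"
  shows "let Q = complex_of_real q; A = complex_of_real a;
             B = complex_of_real b; C = complex_of_real c
         in big_q_jacobi (n + m) x A B C Q =
           (\<Sum>k=0..min n m.
              qpochs [Q powi (- int n), Q powi (- int m), A * B * Q ^ (2 * n + m + 1),
                      x * Q powi (- int k) / A, x * Q powi (- int k) / C] Q k
              / qpochs [Q, A * Q, C * Q, A * Q ^ (n + 1), C * Q ^ (n + 1)] Q k
              * (A * C) ^ k * Q ^ (k * (k + n + 2))
              * big_q_jacobi (n - k) x (A * Q ^ k) (B * Q ^ k) (C * Q ^ k) Q
              * big_q_jacobi (m - k) (x * Q ^ n)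
                  (A * Q ^ (n + k)) (B * Q ^ (n + k)) (C * Q ^ (n + k)) Q)"
proof -
  define Q A B C where "Q = complex_of_real q" and "A = complex_of_real a"
    and "B = complex_of_real b" and "C = complex_of_real c"
  have "q ^ Suc i < 1" for i
    using assms(1,2) by (simp only: power_Suc_less_one)
  moreover have "a * q ^ Suc i < 1" for i
  proof -
    have "a * q < 1"
      using assms(1,4) by (simp add: field_simps)
    moreover have "q ^ i \<le> 1"
      using assms(1,2) by (simp add: power_le_one)
    ultimately have "a * q * q ^ i < 1"
      using assms(1,3) mult_left_le[of "q ^ i" "a * q"]
      by (meson less_imp_le mult_pos_pos order_le_less_trans)
    then show ?thesis by (simp add: mult.assoc)
  qed
  moreover have "c * q ^ Suc i < 1" for i
    using assms(1,7) mult_neg_pos[of c "q ^ Suc i"] by simp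
  ultimately have "q ^ Suc i \<noteq> 1 \<and> a * q ^ Suc i \<noteq> 1 \<and> c * q ^ Suc i \<noteq> 1" for i
    by (metis less_irrefl)
  then have adm: "admissible A C Q"
    unfolding admissible_def A_def C_def Q_def using assms(1,3,7)
    by (simp del: power_Suc flip: of_real_power of_real_mult)
  have "(\<Sum>k\<le>n. leibniz_coeff n m A B C Q k * leibniz_term n m x A B C Q k)
      = (\<Sum>k=0..min n m. leibniz_coeff n m A B C Q k * leibniz_term n m x A B C Q k)"
  proof (rule sum.mono_neutral_right)
    show "\<forall>k\<in>{..n} - {0..min n m}. leibniz_coeff n m A B C Q k * leibniz_term n m x A B C Q k = 0"
      using qpoch_inverse_power_eq_0[OF admissible_nonzero(1)[OF adm], of m]
      by (auto simp: leibniz_coeff_def)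
  qed auto
  then show ?thesis
    unfolding Let_def Q_def[symmetric] A_def[symmetric] B_def[symmetric] C_def[symmetric]
      big_q_jacobi_add[OF adm] leibniz_coeff_def leibniz_term_def weight_ratio_def
      qpochs_def powi_neg
    by (simp only: list.map prod_list.Cons prod_list.Nil mult_1_left mult_1_right
      divide_inverse mult_ac)
qed

end
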